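(* Let $\mathbb{A}$ be an order $m\ge 2$ dimension $n$ nonnegative irreducible tensor with spectral radius $\rho(\mathbb{A})$. Suppose that the cyclic index of $\mathbb{A}$ is $k$ (namely, $\mathbb{A}$ has exactly $k$ distinct eigenvalues with modulus $\rho(\mathbb{A})$). Then $\operatorname{spec}(\mathbb{A})$ (as a multiset) is invariant under a rotation of angle $\frac{2\pi}{k}$ of the complex plane, and therefore $\phi_{\mathbb{A}}(\lambda)=\lambda^r f(\lambda^k)$ for some nonnegative integer $r$ and some polynomial $f(x)$.
   Context: An order $m$ dimension $n$ tensor is an array $\mathbb{A}=(a_{i_1\cdots i_m})$ of complex numbers indexed by $[n]^m$, $[n]=\{1,\dots,n\}$; it is nonnegative if all entries are real and $\ge 0$. It is irreducible if there is no nonempty proper subset $J\subset[n]$ such that $a_{i_1i_2\cdots i_m}=0$ for all $i_1\in J$ and all $i_2,\dots,i_m\notin J$. For $x\in\mathbb{C}^n$, $(\mathbb{A}x)_i=\sum_{i_2,\dots,i_m=1}^n a_{ii_2\cdots i_m}x_{i_2}\cdots x_{i_m}$ and $x^{[m-1]}=(x_1^{m-1},\dots,x_n^{m-1})^T$. A number $\lambda\in\mathbb{C}$ is an eigenvalue of $\mathbb{A}$ if $\mathbb{A}x=\lambda x^{[m-1]}$ for some nonzero $x\in\mathbb{C}^n$. The spectral radius $\rho(\mathbb{A})$ is the maximum modulus of the eigenvalues of $\mathbb{A}$. The unit tensor $\mathbb{I}$ has entry $1$ if all its indices are equal and $0$ otherwise. The hyperdeterminant $\det(\mathbb{A})$ is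 the resultant of the system $\mathbb{A}x=0$ of $n$ homogeneous equations of degree $m-1$, i.e. the unique polynomial in the entries of $\mathbb{A}$ (viewed as independent variables) that vanishes iff $\mathbb{A}x=0$ has a nonzero solution in $\mathbb{C}^n$, equals $1$ at $\mathbb{I}$, and is irreducible. The characteristic polynomial is $\phi_{\mathbb{A}}(\lambda)=\det(\lambda\mathbb{I}-\mathbb{A})$; $\operatorname{spec}(\mathbb{A})$ is the multiset of its roots, whose distinct elements are exactly the eigenvalues of $\mathbb{A}$. *)

theory Defs
  imports
    "HOL-Analysis.Analysis"
    "HOL-Library.Poly_Mapping"
    "HOL-Computational_Algebra.Computational_Algebra"
begin

section \<open>Tensors\<close>

text \<open>
  The index set \<open>[n]\<close> is a finite type \<open>'n\<close>, so the dimension is \<open>CARD('n) \<ge> 1\<close>.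
  An index \<open>(i\<^sub>1, \<dots>, i\<^sub>m)\<close> is a list of length \<open>m\<close>. For a tensor of order \<open>m\<close>, only the
  values on lists of length \<open>m\<close> are entries; everything below ignores all other values.
\<close>

type_synonym 'n tensor = "'n list \<Rightarrow> complex"

definition nonneg_tensor :: "nat \<Rightarrow> 'n tensor \<Rightarrow> bool" where
  "nonneg_tensor m A \<longleftrightarrow> (\<forall>idx. length idx = m \<longrightarrow> A idx \<in> \<real> \<and> 0 \<le> Re (A idx))"

definition irreducible_tensor :: "nat \<Rightarrow> 'n tensor \<Rightarrow> bool" where
  "irreducible_tensor m A \<longleftrightarrow>
     \<not> (\<exists>J. J \<noteq> {} \<and> J \<noteq> UNIV \<and>
           (\<forall>i js. i \<in> J \<longrightarrow> length js = m - 1 \<longrightarrow> (\<forall>j\<in>set js. j \<notin> J) \<longrightarrow> A (i # js) = 0))"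

definition tensor_apply :: "nat \<Rightarrow> 'n tensor \<Rightarrow> complex ^ 'n \<Rightarrow> complex ^ 'n::finite" where
  "tensor_apply m A x =
     (\<chi> i. \<Sum>js | length js = m - 1. A (i # js) * prod_list (map (\<lambda>j. x $ j) js))"

definition vec_power :: "complex ^ 'n \<Rightarrow> nat \<Rightarrow> complex ^ 'n::finite" where
  "vec_power x d = (\<chi> i. (x $ i) ^ d)"

definition tensor_eigenvalues :: "nat \<Rightarrow> 'n::finite tensor \<Rightarrow> complex set" where
  "tensor_eigenvalues m A =
     {z. \<exists>x. x \<noteq> 0 \<and> tensor_apply m A x = z *s vec_power x (m - 1)}"

definition tensor_spectral_radius :: "nat \<Rightarrow> 'n::finite tensor \<Rightarrow> real" where
  "tensor_spectral_radius m A = Max (cmod ` tensor_eigenvalues m A)"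

definition cyclic_index :: "nat \<Rightarrow> 'n::finite tensor \<Rightarrow> nat" where
  "cyclic_index m A =
     card {z \<in> tensor_eigenvalues m A. cmod z = tensor_spectral_radius m A}"

definition unit_tensor :: "'n tensor" where
  "unit_tensor idx = (if \<forall>i\<in>set idx. \<forall>j\<in>set idx. i = j then 1 else 0)"


section \<open>Polynomials in the entries of a tensor\<close>

text \<open>
  A multivariate polynomial maps monomials to coefficients, and a monomial maps variables to
  exponents, both with finite support; multiplication is convolution. The variables are the
  tensor indices.
\<close>

type_synonym 'v mpoly = "('v \<Rightarrow>\<^sub>0 nat) \<Rightarrow>\<^sub>0 complex"

definition mpoly_vars :: "'v mpoly \<Rightarrow> 'v set" where
  "mpoly_vars P = (\<Union>mon \<in> Poly_Mapping.keys P. Poly_Mapping.keys mon)"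

text \<open>Substitute \<open>f v\<close> for each variable \<open>v\<close>, mapping coefficients by \<open>h\<close>.\<close>

definition mpoly_subst :: "(complex \<Rightarrow> 'c::comm_ring_1) \<Rightarrow> ('v \<Rightarrow> 'c) \<Rightarrow> 'v mpoly \<Rightarrow> 'c" where
  "mpoly_subst h f P =
     (\<Sum>mon \<in> Poly_Mapping.keys P.
        h (Poly_Mapping.lookup P mon) *
        (\<Prod>v \<in> Poly_Mapping.keys mon. f v ^ Poly_Mapping.lookup mon v))"

definition mpoly_eval :: "'n tensor \<Rightarrow> 'n list mpoly \<Rightarrow> complex" where
  "mpoly_eval A P = mpoly_subst (\<lambda>c. c) A P"


section \<open>Hyperdeterminant, characteristic polynomial and spectrum\<close>

text \<open>
  The defining property of the hyperdeterminant for order \<open>m\<close> and dimension \<open>CARD('n)\<close>.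
  Irreducibility refers to the polynomial ring in all variables of type \<open>'n list\<close>; since \<open>Det\<close>
  only involves the variables of length \<open>m\<close>, this is the same as irreducibility over
  \<open>\<complex>\<close> in those finitely many variables.
\<close>

definition is_hyperdeterminant :: "nat \<Rightarrow> 'n::finite list mpoly \<Rightarrow> bool" where
  "is_hyperdeterminant m Det \<longleftrightarrow>
     mpoly_vars Det \<subseteq> {idx. length idx = m} \<and>
     (\<forall>A. mpoly_eval A Det = 0 \<longleftrightarrow> (\<exists>x. x \<noteq> 0 \<and> tensor_apply m A x = 0)) \<and>
     mpoly_eval unit_tensor Det = 1 \<and>
     irreducible Det"

text \<open>
  The tensor \<open>\<lambda>\<I> - A\<close> has entries in \<open>\<complex>[\<lambda>]\<close>; they are substituted into \<open>Det\<close>.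
\<close>

definition tensor_charpoly :: "'n list mpoly \<Rightarrow> 'n tensor \<Rightarrow> complex poly" where
  "tensor_charpoly Det A =
     mpoly_subst (\<lambda>c. [:c:]) (\<lambda>idx. [:0, 1:] * [:unit_tensor idx:] - [:A idx:]) Det"

lemma poly_tensor_charpoly:
  "poly (tensor_charpoly Det A) z = mpoly_eval (\<lambda>idx. z * unit_tensor idx - A idx) Det"
  by (simp add: tensor_charpoly_def mpoly_eval_def mpoly_subst_def poly_sum poly_prod)

definition tensor_spec :: "'n list mpoly \<Rightarrow> 'n tensor \<Rightarrow> complex multiset" where
  "tensor_spec Det A = proots (tensor_charpoly Det A)"

end

theory Submission
  imports Defs
begin

text \<open>
  Let \<open>x\<close> be a positive Perron vector of \<open>A\<close>. If \<open>y\<close> is an eigenvector for an eigenvalue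
  \<open>w \<rho>\<close> of maximal modulus, then \<open>\<bar>y\<bar>\<close> is a multiple of \<open>x\<close>, and equality in the triangle
  inequality shows that the phases \<open>d\<close> of \<open>y\<close> satisfy
  \<open>d j\<^sub>2 \<dots> d j\<^sub>m = w (d i)\<^bsup>m - 1\<^esup>\<close> wherever the entry of \<open>A\<close> at \<open>(i, j\<^sub>2, \<dots>, j\<^sub>m)\<close> is nonzero.
  The admissible \<open>w\<close> form a finite group, so \<open>w = cis (2 \<pi> / k)\<close> is admissible; rescaling
  rows and columns by \<open>d\<close> then carries the pencil at \<open>w z\<close> to the pencil at \<open>z\<close>.
  Such scalings change the hyperdeterminant by a nonzero factor. This only uses that they preserve
  its zero set: as a function of a single scaling parameter \<open>t\<close> it is a polynomial
  without nonzero roots, hence a multiple of a power of \<open>t\<close>.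
\<close>

section \<open>Diagonal scalings and the hyperdeterminant\<close>

lemma poly_mpoly_subst:
  "poly (mpoly_subst h f P) x = mpoly_subst (\<lambda>c. poly (h c) x) (\<lambda>v. poly (f v) x) P"
  by (simp add: mpoly_subst_def poly_sum poly_prod)

lemma mpoly_eval_cong:
  assumes "\<And>idx. idx \<in> mpoly_vars P \<Longrightarrow> A idx = B idx"
  shows "mpoly_eval A P = mpoly_eval B P"
  unfolding mpoly_eval_def mpoly_subst_def
  by (intro sum.cong refl arg_cong2[where f = "(*)"] prod.cong)
     (auto simp: mpoly_vars_def intro!: assms arg_cong[where f = "\<lambda>x. x ^ _"])

text \<open>Splitting off the full power of the variable leaves a cofactor without any root, and
  over the complex numbers such a cofactor is constant.\<close>

lemma complex_poly_nonvanishing_monom: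
  fixes q :: "complex poly"
  assumes "\<And>t. t \<noteq> 0 \<Longrightarrow> poly q t \<noteq> 0"
  obtains c b where "q = monom c b"
proof -
  have "q \<noteq> 0" using assms[of 1] by auto
  then obtain r where r: "q = [:- 0, 1:] ^ order 0 q * r" "\<not> [:- 0, 1:] dvd r"
    using order_decomp[of q 0] by blast
  have "poly r 0 \<noteq> 0" using r(2) by (simp add: poly_eq_0_iff_dvd)
  moreover have "poly r t \<noteq> 0" if "t \<noteq> 0" for t
    using assms[OF that] r(1) by (metis mult_zero_right poly_mult)
  ultimately have "\<And>t. poly r t \<noteq> 0" by metis
  then obtain c where "r = [:c:]"
    using fundamental_theorem_of_algebra_alt[of r] by (metis)
  then have "q = monom c (order 0 q)"
    using r(1) by (simp add: monom_altdef)
  then show thesis by (rule that)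
qed

text \<open>\<open>P\<close> is read as a polynomial in \<open>t\<close> whose coefficients are
  polynomials in \<open>z\<close>. Fixing \<open>z\<close> first is what permits a one-variable
  argument in \<open>t\<close>.\<close>

lemma poly_map_poly_eval:
  "poly (map_poly (\<lambda>p. poly p z) P) t = poly (poly P [:t:]) z" for P :: "'a::comm_ring_1 poly poly"
  by (induction P) (simp_all add: map_poly_pCons)

text \<open>At every \<open>z\<close> with \<open>poly (poly P 1) z\<close> nonzero, a monomial in
  \<open>t\<close> is left, so two different coefficients of \<open>P\<close> are never both nonzero
  there. Since polynomials in \<open>z\<close> form an integral domain, a second nonzero coefficient
  is impossible.\<close>

lemma bivariate_nonvanishing_monom:
  fixes P :: "complex poly poly"
  assumes "poly P 1 \<noteq> 0"
    and nz: "\<And>z t. t \<noteq> 0 \<Longrightarrow> poly (poly P 1) z \<noteq> 0 \<Longrightarrow> poly (poly P [:t:]) z \<noteq> 0"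
  obtains p b where "P = monom p b"
proof -
  have "P \<noteq> 0" using assms(1) by auto
  define b where "b = degree P"
  have b: "coeff P b \<noteq> 0" using \<open>P \<noteq> 0\<close> by (simp add: b_def)
  have "coeff P j = 0" if "j \<noteq> b" for j
  proof -
    \<comment> \<open>The factor \<open>poly P 1\<close> makes the product vanish also at those
      \<open>z\<close> where \<open>nz\<close> gives nothing.\<close>
    have "poly (coeff P j * coeff P b * poly P 1) z = 0" for z
    proof (cases "poly (poly P 1) z = 0")
      case False
      then have "poly (map_poly (\<lambda>p. poly p z) P) t \<noteq> 0" if "t \<noteq> 0" for t
        using nz[OF that] by (simp add: poly_map_poly_eval)
      then obtain c e where *: "map_poly (\<lambda>p. poly p z) P = monom c e"
        using complex_poly_nonvanishing_monom by blast
      have "poly (coeff P i) z = (if i = e then c else 0)" for i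
        using arg_cong[OF *, of "\<lambda>q. coeff q i"] by (simp add: coeff_map_poly)
      then show ?thesis using \<open>j \<noteq> b\<close> by auto
    qed simp
    then have "coeff P j * coeff P b * poly P 1 = 0"
      by (metis poly_all_0_iff_0)
    then show ?thesis using b assms(1) by simp
  qed
  then have "P = monom (coeff P b) b"
    by (intro poly_eqI) simp
  then show thesis by (rule that)
qed

text \<open>The factor \<open>c\<close> may depend on the pencil \<open>F\<close> but not on
  \<open>z\<close>; this controls multiplicities of roots and not just the zero set. Quantifying
  over all pencils makes the notion stable under products, because a scaled pencil is again a
  pencil.\<close>

definition pencil_scaling :: "'n list mpoly \<Rightarrow> ('n list \<Rightarrow> complex) \<Rightarrow> bool" where
  "pencil_scaling Det g \<longleftrightarrow>
     (\<forall>F. \<exists>c. c \<noteq> 0 \<and>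
       (\<forall>z. mpoly_eval (\<lambda>idx. g idx * poly (F idx) z) Det = c * mpoly_eval (\<lambda>idx. poly (F idx) z) Det))"

lemma pencil_scaling_one: "pencil_scaling Det (\<lambda>_. 1)"
  unfolding pencil_scaling_def by (intro allI exI[of _ 1]) simp

lemma pencil_scaling_mult:
  assumes "pencil_scaling Det g" "pencil_scaling Det h"
  shows "pencil_scaling Det (\<lambda>idx. g idx * h idx)"
  unfolding pencil_scaling_def
proof
  fix F :: "'a list \<Rightarrow> complex poly"
  obtain c where c: "c \<noteq> 0"
    "\<And>z. mpoly_eval (\<lambda>idx. h idx * poly (F idx) z) Det = c * mpoly_eval (\<lambda>idx. poly (F idx) z) Det"
    using assms(2) unfolding pencil_scaling_def by blast
  obtain d where d: "d \<noteq> 0"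
    "\<And>z. mpoly_eval (\<lambda>idx. g idx * poly (smult (h idx) (F idx)) z) Det
       = d * mpoly_eval (\<lambda>idx. poly (smult (h idx) (F idx)) z) Det"
    using assms(1)[unfolded pencil_scaling_def, rule_format, of "\<lambda>idx. smult (h idx) (F idx)"] by blast
  show "\<exists>c. c \<noteq> 0 \<and> (\<forall>z. mpoly_eval (\<lambda>idx. g idx * h idx * poly (F idx) z) Det
      = c * mpoly_eval (\<lambda>idx. poly (F idx) z) Det)"
    using c d by (intro exI[of _ "d * c"]) (simp add: mult.assoc)
qed

lemma pencil_scaling_prod:
  assumes "finite I" "\<And>i. i \<in> I \<Longrightarrow> pencil_scaling Det (g i)"
  shows "pencil_scaling Det (\<lambda>idx. \<Prod>i\<in>I. g i idx)"
  using assms by (induction I) (simp_all add: pencil_scaling_one pencil_scaling_mult)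

text \<open>
  For fixed \<open>z\<close>, the value at the scaled pencil is a polynomial in \<open>t\<close> without nonzero roots,
  hence a monomial in \<open>t\<close>; its exponent cannot depend on \<open>z\<close>.
\<close>

lemma pencil_scaling_weight:
  assumes zero: "\<And>B s. s \<noteq> 0 \<Longrightarrow>
      mpoly_eval (\<lambda>idx. s ^ w idx * B idx) Det = 0 \<longleftrightarrow> mpoly_eval B Det = 0"
    and "t \<noteq> 0"
  shows "pencil_scaling Det (\<lambda>idx. t ^ w idx)"
  unfolding pencil_scaling_def
proof
  fix F :: "'a list \<Rightarrow> complex poly"
  \<comment> \<open>The scaling parameter is the outer variable and \<open>z\<close> the inner one;
    the weight of an index becomes the exponent of the parameter.\<close>
  define P :: "complex poly poly"
    where "P = mpoly_subst (\<lambda>c. [:[:c:]:]) (\<lambda>idx. monom (F idx) (w idx)) Det"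
  have P: "poly (poly P [:s:]) z = mpoly_eval (\<lambda>idx. s ^ w idx * poly (F idx) z) Det" for s z
    by (simp add: P_def poly_mpoly_subst mpoly_eval_def poly_monom mult.commute)
  have P1: "poly (poly P 1) z = mpoly_eval (\<lambda>idx. poly (F idx) z) Det" for z
    using P[of 1] by (simp flip: one_pCons)
  have iff: "poly (poly P [:s:]) z = 0 \<longleftrightarrow> poly (poly P 1) z = 0" if "s \<noteq> 0" for s z
    unfolding P P1 using zero[OF that] .
  show "\<exists>c. c \<noteq> 0 \<and> (\<forall>z. mpoly_eval (\<lambda>idx. t ^ w idx * poly (F idx) z) Det
      = c * mpoly_eval (\<lambda>idx. poly (F idx) z) Det)"
  \<comment> \<open>If the unscaled pencil gives the zero polynomial, the scaled one does too and
    the factor 1 will do; otherwise the factor is \<open>t ^ b\<close>.\<close>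
  proof (cases "poly P 1 = 0")
    case True
    then show ?thesis
      using iff[OF \<open>t \<noteq> 0\<close>] unfolding P P1[symmetric] by (intro exI[of _ 1]) simp
  next
    case False
    then obtain p b where "P = monom p b"
      using bivariate_nonvanishing_monom[of P] iff by blast
    then show ?thesis
      using \<open>t \<noteq> 0\<close> unfolding P[symmetric] P1[symmetric]
      by (intro exI[of _ "t ^ b"]) (simp add: poly_monom poly_const_pow mult.commute)
  qed
qed

lemma mpoly_eval_eq_0_iff:
  assumes "is_hyperdeterminant m Det"
  shows "mpoly_eval B Det = 0 \<longleftrightarrow> (\<exists>x. x \<noteq> 0 \<and> tensor_apply m B x = 0)"
  using assms unfolding is_hyperdeterminant_def by blast

lemma tensor_apply_nth:
  "tensor_apply m B x $ i = (\<Sum>js | length js = m - 1. B (i # js) * prod_list (map (($) x) js))"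
  by (simp add: tensor_apply_def)

text \<open>A row is one equation of the system, and multiplying it by a nonzero number keeps its
  solutions.\<close>

lemma pencil_scaling_row:
  fixes Det :: "'n::finite list mpoly"
  assumes "is_hyperdeterminant m Det" "t \<noteq> 0"
  shows "pencil_scaling Det (\<lambda>idx. t ^ of_bool (hd idx = i))"
proof (rule pencil_scaling_weight[OF _ \<open>t \<noteq> 0\<close>])
  fix B :: "'n list \<Rightarrow> complex" and s :: complex
  assume s: "s \<noteq> 0"
  have *: "tensor_apply m (\<lambda>idx. s ^ of_bool (hd idx = i) * B idx) x $ i' =
        s ^ of_bool (i' = i) * tensor_apply m B x $ i'" for x i'
    by (simp add: tensor_apply_nth sum_distrib_left mult.assoc)
  have "tensor_apply m (\<lambda>idx. s ^ of_bool (hd idx = i) * B idx) x = 0 \<longleftrightarrow> tensor_apply m B x = 0" for x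
    unfolding vec_eq_iff using s by (simp add: *)
  then show "mpoly_eval (\<lambda>idx. s ^ of_bool (hd idx = i) * B idx) Det = 0 \<longleftrightarrow> mpoly_eval B Det = 0"
    by (simp add: mpoly_eval_eq_0_iff[OF assms(1)])
qed

lemma prod_list_map_scale_coordinate:
  fixes s :: "'a::comm_monoid_mult"
  shows "prod_list (map (\<lambda>l. if l = j then s * x l else x l) js) = s ^ count_list js j * prod_list (map x js)"
  by (induction js) (simp_all add: ac_simps)

text \<open>This scaling amounts to replacing the coordinate \<open>x $ j\<close> by
  \<open>s * x $ j\<close>, an invertible substitution that maps nonzero vectors to nonzero
  vectors.\<close>

lemma pencil_scaling_column:
  fixes Det :: "'n::finite list mpoly"
  assumes "is_hyperdeterminant m Det" "t \<noteq> 0"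
  shows "pencil_scaling Det (\<lambda>idx. t ^ count_list (tl idx) j)"
proof (rule pencil_scaling_weight[OF _ \<open>t \<noteq> 0\<close>])
  fix B :: "'n list \<Rightarrow> complex" and s :: complex
  assume s: "s \<noteq> 0"
  define S :: "complex \<Rightarrow> complex ^ 'n \<Rightarrow> complex ^ 'n"
    where "S = (\<lambda>u x. \<chi> l. if l = j then u * x $ l else x $ l)"
  have SS: "S s (S (1 / s) x) = x" for x
    using s by (simp add: S_def vec_eq_iff)
  have S0: "S u x = 0 \<longleftrightarrow> x = 0" if "u \<noteq> 0" for u x
    using that by (auto simp: S_def vec_eq_iff)
  have *: "tensor_apply m (\<lambda>idx. s ^ count_list (tl idx) j * B idx) x = tensor_apply m B (S s x)" for x
  proof -
    have "($) (S s x) = (\<lambda>l. if l = j then s * x $ l else x $ l)"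
      by (simp add: S_def fun_eq_iff)
    then show ?thesis
      by (simp add: vec_eq_iff tensor_apply_nth prod_list_map_scale_coordinate ac_simps)
  qed
  have "(\<exists>x. x \<noteq> 0 \<and> tensor_apply m B (S s x) = 0) \<longleftrightarrow> (\<exists>x. x \<noteq> 0 \<and> tensor_apply m B x = 0)"
    using SS S0 s by (metis divide_eq_0_iff one_neq_zero)
  then show "mpoly_eval (\<lambda>idx. s ^ count_list (tl idx) j * B idx) Det = 0 \<longleftrightarrow> mpoly_eval B Det = 0"
    by (simp add: mpoly_eval_eq_0_iff[OF assms(1)] *)
qed

text \<open>Regrouping by letters turns a diagonal scaling of the columns into a finite product of
  one-parameter scalings.\<close>

lemma prod_list_map_eq_prod_count:
  fixes d :: "'n::finite \<Rightarrow> 'a::comm_monoid_mult"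
  shows "prod_list (map d js) = (\<Prod>j\<in>UNIV. d j ^ count_list js j)"
proof (induction js)
  case (Cons a js)
  have "(\<Prod>j\<in>UNIV. d j ^ count_list (a # js) j) = (\<Prod>j\<in>UNIV. (if j = a then d j else 1) * d j ^ count_list js j)"
    by (intro prod.cong) auto
  also have "\<dots> = d a * prod_list (map d js)"
    by (simp add: prod.distrib Cons)
  finally show ?case by simp
qed simp

lemma pencil_scaling_diagonal:
  fixes Det :: "'n::finite list mpoly"
  assumes det: "is_hyperdeterminant m Det"
    and "\<And>i. r i \<noteq> 0" "\<And>j. d j \<noteq> 0"
  shows "pencil_scaling Det (\<lambda>idx. r (hd idx) * prod_list (map d (tl idx)))"
proof -
  have "r (hd idx) * prod_list (map d (tl idx)) =
     (\<Prod>i\<in>UNIV. r i ^ of_bool (hd idx = i)) * (\<Prod>j\<in>UNIV. d j ^ count_list (tl idx) j)" for idx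
  proof -
    have "(\<Prod>i\<in>UNIV. r i ^ of_bool (hd idx = i)) = (\<Prod>i\<in>UNIV. if hd idx = i then r i else 1)"
      by (intro prod.cong) auto
    then show ?thesis by (simp add: prod_list_map_eq_prod_count)
  qed
  then show ?thesis
    using assms
    by (auto intro!: pencil_scaling_mult pencil_scaling_prod pencil_scaling_row[OF det] pencil_scaling_column[OF det])
qed

section \<open>Rotational symmetry of the characteristic polynomial\<close>

text \<open>This is diagonal similarity of \<open>A\<close> and \<open>w\<close> times
  \<open>A\<close> through a diagonal matrix of phases, written without division and on the support
  of \<open>A\<close>.\<close>

definition phase_symmetry :: "nat \<Rightarrow> 'n tensor \<Rightarrow> complex \<Rightarrow> ('n \<Rightarrow> complex) \<Rightarrow> bool" where
  "phase_symmetry m A w d \<longleftrightarrow> cmod w = 1 \<and> (\<forall>i. cmod (d i) = 1) \<and>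
     (\<forall>i js. length js = m - 1 \<longrightarrow> A (i # js) \<noteq> 0 \<longrightarrow> prod_list (map d js) = w * d i ^ (m - 1))"

lemma phase_symmetry_mult:
  assumes "phase_symmetry m A w d" "phase_symmetry m A v e"
  shows "phase_symmetry m A (w * v) (\<lambda>i. d i * e i)"
proof -
  have "prod_list (map (\<lambda>i. d i * e i) js) = prod_list (map d js) * prod_list (map e js)" for js
    by (induction js) simp_all
  with assms show ?thesis
    by (auto simp: phase_symmetry_def norm_mult power_mult_distrib)
qed

lemma unit_tensor_Cons:
  "unit_tensor (i # js) = (if set js \<subseteq> {i} then 1 else 0)"
  by (auto simp: unit_tensor_def)

text \<open>A diagonal scaling carries the pencil at \<open>w * z\<close> to the pencil at
  \<open>z\<close>, and it costs a factor independent of \<open>z\<close>. Knowing the rotated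
  polynomial up to this factor is enough for its roots and for its support.\<close>

lemma tensor_charpoly_rotation:
  fixes A :: "'n::finite tensor"
  assumes "m \<ge> 2" and det: "is_hyperdeterminant m Det"
    and sym: "phase_symmetry m A w d"
  obtains c where "c \<noteq> 0"
    "pcompose (tensor_charpoly Det A) [:0, w:] = smult c (tensor_charpoly Det A)"
proof -
  have w: "w \<noteq> 0" and d: "\<And>i. d i \<noteq> 0"
    using sym unfolding phase_symmetry_def by (metis norm_zero zero_neq_one)+
  text \<open>This scaling fixes \<open>A\<close> and multiplies the unit tensor by \<open>1 / w\<close>.\<close>
  define g where "g = (\<lambda>idx. 1 / (w * d (hd idx) ^ (m - 1)) * prod_list (map d (tl idx)))"
  have "pencil_scaling Det g"
    unfolding g_def using w d
    by (intro pencil_scaling_diagonal[OF det, of "\<lambda>i. 1 / (w * d i ^ (m - 1))" d]) auto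
  \<comment> \<open>The pencil has the linear entries \<open>[:- A idx, unit_tensor idx:]\<close> in
    \<open>z\<close>.\<close>
  then obtain c where c: "c \<noteq> 0" "\<And>z. mpoly_eval (\<lambda>idx. g idx * (z * unit_tensor idx - A idx)) Det =
      c * mpoly_eval (\<lambda>idx. z * unit_tensor idx - A idx) Det"
    unfolding pencil_scaling_def by (auto dest!: spec[where x = "\<lambda>idx. [:- A idx, unit_tensor idx:]"])
  \<comment> \<open>Phase symmetry says nothing about lists of other lengths, but no variable of
    \<open>Det\<close> is such a list.\<close>
  have g: "g idx * (w * z * unit_tensor idx - A idx) = z * unit_tensor idx - A idx"
    if "length idx = m" for idx z
  proof -
    obtain i js where idx: "idx = i # js" "length js = m - 1"
      using \<open>length idx = m\<close> \<open>m \<ge> 2\<close> by (cases idx) auto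
    have "g idx * A idx = A idx"
      using sym idx w d by (cases "A idx = 0") (auto simp: g_def phase_symmetry_def)
    moreover have "g idx * w * unit_tensor idx = unit_tensor idx"
    proof (cases "set js \<subseteq> {i}")
      case True
      then have "js = replicate (m - 1) i"
        using idx(2) by (metis replicate_eqI singletonD subsetD)
      then have "prod_list (map d js) = d i ^ (m - 1)" by (simp add: prod_list_replicate)
      then show ?thesis using w d by (simp add: g_def idx(1))
    qed (simp add: idx(1) unit_tensor_Cons)
    moreover have "g idx * (w * z * unit_tensor idx - A idx) = z * (g idx * w * unit_tensor idx) - g idx * A idx"
      by (simp add: algebra_simps)
    ultimately show ?thesis by (simp only:)
  qed
  have vars: "length idx = m" if "idx \<in> mpoly_vars Det" for idx
    using det that unfolding is_hyperdeterminant_def by auto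
  have "poly (pcompose (smult c (tensor_charpoly Det A)) [:0, w:]) z = poly (tensor_charpoly Det A) z" for z
  proof -
    have "poly (pcompose (smult c (tensor_charpoly Det A)) [:0, w:]) z
        = c * mpoly_eval (\<lambda>idx. w * z * unit_tensor idx - A idx) Det"
      by (simp add: pcompose_smult poly_pcompose mult.commute[of z w] flip: poly_tensor_charpoly)
    also have "\<dots> = mpoly_eval (\<lambda>idx. g idx * (w * z * unit_tensor idx - A idx)) Det"
      by (simp only: c(2))
    also have "\<dots> = mpoly_eval (\<lambda>idx. z * unit_tensor idx - A idx) Det"
      by (intro mpoly_eval_cong g vars)
    finally show ?thesis by (simp add: poly_tensor_charpoly)
  qed
  then have "pcompose (smult c (tensor_charpoly Det A)) [:0, w:] = tensor_charpoly Det A"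
    by (simp add: fun_eq_iff flip: poly_eq_poly_eq_iff)
  \<comment> \<open>So far \<open>c\<close> stands on the rotated side; dividing by it yields the
    witness \<open>1 / c\<close>.\<close>
  then have "smult (1 / c) (smult c (pcompose (tensor_charpoly Det A) [:0, w:])) = smult (1 / c) (tensor_charpoly Det A)"
    by (simp only: pcompose_smult)
  then show thesis using c(1) that[of "1 / c"] by simp
qed

section \<open>Roots and coefficients of a polynomial that a rotation fixes up to a factor\<close>

text \<open>Substitution turns the linear factor at \<open>w * a\<close> into \<open>w\<close> times
  the linear factor at \<open>a\<close>, while the cofactor stays nonzero at
  \<open>a\<close>.\<close>

lemma order_pcompose_scale:
  fixes p :: "'a::field poly"
  assumes "p \<noteq> 0" "w \<noteq> 0"
  shows "order a (pcompose p [:0, w:]) = order (w * a) p"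
proof -
  obtain q where q: "p = [:- (w * a), 1:] ^ order (w * a) p * q" "\<not> [:- (w * a), 1:] dvd q"
    using order_decomp[OF assms(1)] by blast
  define n where "n = order (w * a) p"
  have lin: "pcompose [:- (w * a), 1:] [:0, w:] = smult w [:- a, 1:]"
    by (simp add: pcompose_pCons)
  have pow: "pcompose (u ^ n) v = pcompose u v ^ n" for u v :: "'a poly"
    by (induction n) (simp_all add: pcompose_mult pcompose_1)
  have "pcompose p [:0, w:] = smult (w ^ n) ([:- a, 1:] ^ n * pcompose q [:0, w:])"
    by (subst q(1)) (simp only: n_def[symmetric] pcompose_mult pow lin smult_power mult_smult_left)
  moreover have "poly (pcompose q [:0, w:]) a \<noteq> 0"
    using q(2) by (simp add: poly_pcompose poly_eq_0_iff_dvd mult.commute)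
  moreover from this have "[:- a, 1:] ^ n * pcompose q [:0, w:] \<noteq> 0"
    by (metis mult_eq_0_iff order_2 order_power_n_n pCons_eq_0_iff poly_0 power_not_zero zero_neq_one)
  ultimately show ?thesis
    using assms(2) by (simp add: order_smult order_mult order_power_n_n order_0I flip: n_def)
qed

text \<open>The multiplicity of \<open>y\<close> in the rotated multiset is the order of
  \<open>p\<close> at \<open>y / w\<close>, which the functional equation equates with the order at
  \<open>y\<close>.\<close>

lemma proots_rotation_invariant:
  fixes p :: "'a::field poly"
  assumes "p \<noteq> 0" "w \<noteq> 0" "c \<noteq> 0" "pcompose p [:0, w:] = smult c p"
  shows "image_mset (\<lambda>z. w * z) (proots p) = proots p"
proof (rule multiset_eqI)
  fix y
  have "inj (\<lambda>z. w * z)" using assms(2) by (auto simp: inj_def)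
  then have "(\<lambda>z. w * z) -` {y} = {y / w}"
    using assms(2) by (auto simp: field_simps)
  then have "count (image_mset (\<lambda>z. w * z) (proots p)) y = count (proots p) (y / w)"
    unfolding count_image_mset by (cases "y / w \<in># proots p") (simp_all add: not_in_iff del: set_count_proots count_proots)
  moreover have "order (y / w) p = order y p"
    using order_pcompose_scale[OF assms(1,2), of "y / w"] assms by (simp add: order_smult)
  ultimately show "count (image_mset (\<lambda>z. w * z) (proots p)) y = count (proots p) y"
    using assms(1,2) by simp
qed

text \<open>This expresses that \<open>cis (2 * pi / real k)\<close> is a primitive
  \<open>k\<close>-th root of unity.\<close>

lemma cis_power_eq_imp_dvd:
  assumes "k > 0" "cis (2 * pi / real k) ^ j = cis (2 * pi / real k) ^ r" "r \<le> j"
  shows "k dvd j - r"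
proof -
  have "cis (2 * pi / real k) ^ (j - r) = 1"
    using assms(2,3) by (simp add: power_diff)
  then have "cos (real (j - r) * (2 * pi / real k)) = 1"
    unfolding Complex.DeMoivre by (simp add: complex_eq_iff)
  then obtain x :: int where "real (j - r) * (2 * pi / real k) = x * 2 * pi"
    by (auto simp: cos_one_2pi_int)
  then have "real (j - r) = x * real k"
    using assms(1) by (simp add: field_simps)
  then have "int (j - r) = x * int k"
    by (metis of_int_eq_iff of_int_mult of_int_of_nat_eq)
  then show ?thesis by (metis dvd_triv_right int_dvd_int_iff)
qed

text \<open>Comparing coefficients gives \<open>cis (2 * pi / real k) ^ j = c\<close> for every
  exponent \<open>j\<close> in the support, so all these exponents are congruent modulo
  \<open>k\<close> to the least one, \<open>r\<close>.\<close>

lemma rotation_imp_pcompose_monom: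
  assumes "p \<noteq> 0" "k > 0" "pcompose p [:0, cis (2 * pi / real k):] = smult c p"
  shows "\<exists>r f. p = monom 1 r * pcompose f (monom 1 k)"
proof -
  let ?w = "cis (2 * pi / real k)"
  have "coeff (pcompose p [:0, ?w:]) j = ?w ^ j * coeff p j" for j
    by (simp add: coeff_pcompose_linear)
  then have co: "?w ^ j = c" if "coeff p j \<noteq> 0" for j
    using assms(3) that by (metis coeff_smult mult_right_cancel)
  define r where "r = (LEAST j. coeff p j \<noteq> 0)"
  have ex: "\<exists>j. coeff p j \<noteq> 0" using assms(1) by (simp add: poly_eq_iff)
  have r: "coeff p r \<noteq> 0" unfolding r_def using ex by (rule LeastI_ex)
  have rle: "r \<le> j" if "coeff p j \<noteq> 0" for j
    unfolding r_def using that by (rule Least_le)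
  \<comment> \<open>The bound \<open>degree p\<close> is generous: summands with
    \<open>r + k * i\<close> beyond the degree have coefficient 0.\<close>
  define f where "f = (\<Sum>i\<le>degree p. monom (coeff p (r + k * i)) i)"
  have "monom 1 r * pcompose f (monom 1 k) = (\<Sum>i\<le>degree p. monom (coeff p (r + k * i)) (r + k * i))"
  proof -
    have "pcompose (monom a i) (monom 1 k) = monom a (k * i)" for a :: complex and i
    proof -
      have "pcompose (monom a i) (monom 1 k) = smult a (monom 1 k ^ i)"
        by (induction i) (simp_all add: monom_0 monom_Suc pcompose_pCons)
      then show ?thesis by (simp add: monom_power smult_monom)
    qed
    then show ?thesis
      by (simp add: f_def pcompose_sum sum_distrib_left mult_monom)
  qed
  also have "\<dots> = p"
  proof (rule poly_eqI)
    fix j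
    have *: "coeff (\<Sum>i\<le>degree p. monom (coeff p (r + k * i)) (r + k * i)) j
        = (\<Sum>i\<le>degree p. if r + k * i = j then coeff p j else 0)"
      by (simp add: coeff_sum cong: if_cong)
    show "coeff (\<Sum>i\<le>degree p. monom (coeff p (r + k * i)) (r + k * i)) j = coeff p j"
    proof (cases "coeff p j = 0")
      case False
      have "k dvd j - r"
        using cis_power_eq_imp_dvd[OF assms(2)] co[OF False] co[OF r] rle[OF False] by simp
      then obtain i where i: "j = r + k * i"
        using rle[OF False] by (metis dvdE le_add_diff_inverse)
      have "i \<le> j" using i assms(2) by (simp add: trans_le_add2)
      then have "i \<le> degree p" using le_degree[OF False] by simp
      have "(\<Sum>i'\<le>degree p. if r + k * i' = j then coeff p j else 0) = (\<Sum>i'\<le>degree p. if i' = i then coeff p j else 0)"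
        using i assms(2) by (intro sum.cong) auto
      then show ?thesis using * \<open>i \<le> degree p\<close> by simp
    next
      case True
      then show ?thesis unfolding * by (simp cong: if_cong)
    qed
  qed
  finally show ?thesis by metis
qed

section \<open>Perron--Frobenius theory\<close>

text \<open>For a nonnegative tensor, taking \<open>Re\<close> loses nothing, and order arguments
  can be carried out over the reals.\<close>

definition real_apply :: "nat \<Rightarrow> 'n::finite tensor \<Rightarrow> ('n \<Rightarrow> real) \<Rightarrow> 'n \<Rightarrow> real" where
  "real_apply m A x i = (\<Sum>js | length js = m - 1. Re (A (i # js)) * prod_list (map x js))"

lemma finite_lists_length: "finite {js :: 'n::finite list. length js = l}"
  using finite_lists_length_eq[of "UNIV :: 'n set" l] by simp

lemma prod_list_map_nonneg:
  fixes f :: "'a \<Rightarrow> real"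
  assumes "\<And>j. j \<in> set js \<Longrightarrow> 0 \<le> f j"
  shows "0 \<le> prod_list (map f js)"
  using assms by (induction js) auto

lemma prod_list_map_pos:
  fixes f :: "'a \<Rightarrow> real"
  assumes "\<And>j. j \<in> set js \<Longrightarrow> 0 < f j"
  shows "0 < prod_list (map f js)"
  using assms by (induction js) auto

lemma prod_list_map_mono:
  fixes f g :: "'a \<Rightarrow> real"
  assumes "\<And>j. j \<in> set js \<Longrightarrow> 0 \<le> f j \<and> f j \<le> g j"
  shows "prod_list (map f js) \<le> prod_list (map g js)"
  using assms
proof (induction js)
  case (Cons a js)
  then have "0 \<le> prod_list (map f js)" "0 \<le> g a"
    by (auto intro!: prod_list_map_nonneg order.trans[of 0 "f a" "g a"])
  with Cons show ?case by (auto intro!: mult_mono)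
qed simp

lemma prod_list_map_strict_mono:
  fixes f g :: "'a \<Rightarrow> real"
  assumes "\<And>j. j \<in> set js \<Longrightarrow> 0 \<le> f j \<and> f j < g j" "js \<noteq> []"
  shows "prod_list (map f js) < prod_list (map g js)"
proof -
  obtain a as where js: "js = a # as" using assms(2) by (cases js) auto
  have "0 < prod_list (map g as)"
    using assms(1) js by (intro prod_list_map_pos) (auto intro: le_less_trans)
  moreover have "prod_list (map f as) \<le> prod_list (map g as)"
    using assms(1) js by (intro prod_list_map_mono) (auto intro: less_imp_le)
  ultimately have "f a * prod_list (map f as) \<le> f a * prod_list (map g as)"
      "f a * prod_list (map g as) < g a * prod_list (map g as)"
    using assms(1)[of a] js by (auto intro: mult_left_mono mult_strict_right_mono)
  then show ?thesis by (simp add: js)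
qed

lemma prod_list_map_cmult:
  fixes x :: "'n \<Rightarrow> 'a::comm_monoid_mult"
  shows "prod_list (map (\<lambda>j. t * x j) js) = t ^ length js * prod_list (map x js)"
  by (induction js) (simp_all add: ac_simps)

lemma real_apply_cmult: "real_apply m A (\<lambda>j. t * x j) i = t ^ (m - 1) * real_apply m A x i"
  by (simp add: real_apply_def prod_list_map_cmult sum_distrib_left ac_simps)

lemma nonneg_tensorD:
  assumes "nonneg_tensor m A" "m \<ge> 2" "length js = m - 1"
  shows "A (i # js) = of_real (Re (A (i # js)))" "0 \<le> Re (A (i # js))"
proof -
  have "length (i # js) = m" using assms(2,3) by simp
  then show "A (i # js) = of_real (Re (A (i # js)))" "0 \<le> Re (A (i # js))"
    using assms(1) unfolding nonneg_tensor_def by (auto simp: complex_is_Real_iff complex_eq_iff)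
qed

lemma real_apply_nonneg:
  assumes "nonneg_tensor m A" "m \<ge> 2" "\<And>j. 0 \<le> x j"
  shows "0 \<le> real_apply m A x i"
  unfolding real_apply_def
  by (intro sum_nonneg mult_nonneg_nonneg prod_list_map_nonneg assms(3))
     (use nonneg_tensorD(2)[OF assms(1,2)] in auto)

lemma real_apply_mono:
  assumes "nonneg_tensor m A" "m \<ge> 2" "\<And>j. 0 \<le> x j" "\<And>j. x j \<le> y j"
  shows "real_apply m A x i \<le> real_apply m A y i"
  unfolding real_apply_def
  by (intro sum_mono mult_left_mono prod_list_map_mono)
     (use nonneg_tensorD(2)[OF assms(1,2)] assms(3,4) in auto)

lemma irreducible_tensorE:
  assumes "irreducible_tensor m A" "J \<noteq> {}" "J \<noteq> UNIV"
  obtains i js where "i \<in> J" "length js = m - 1" "\<And>j. j \<in> set js \<Longrightarrow> j \<notin> J" "A (i # js) \<noteq> 0"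
proof -
  have "\<exists>i js. i \<in> J \<and> length js = m - 1 \<and> (\<forall>j\<in>set js. j \<notin> J) \<and> A (i # js) \<noteq> 0"
    using assms(1)[unfolded irreducible_tensor_def not_ex, rule_format, of J] assms(2,3) by blast
  then show thesis using that by blast
qed

text \<open>If the zero set of \<open>x\<close> were nonempty, irreducibility would give a row
  \<open>l\<close> in it with a nonzero entry all of whose column indices lie outside. Then the
  image at \<open>l\<close> would be positive, although \<open>x l = 0\<close>.\<close>

lemma perron_vector_pos:
  fixes A :: "'n::finite tensor"
  assumes A: "nonneg_tensor m A" "m \<ge> 2" and irr: "irreducible_tensor m A"
    and x: "\<And>i. 0 \<le> x i" "\<exists>i. x i \<noteq> 0"
    and eig: "\<And>i. real_apply m A x i = r * x i ^ (m - 1)"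
  shows "0 < x i"
proof (rule ccontr)
  assume "\<not> 0 < x i"
  then have "{i. x i = 0} \<noteq> {}" using x(1)[of i] by auto
  moreover have "{i. x i = 0} \<noteq> UNIV" using x(2) by auto
  ultimately obtain l js where l: "x l = 0" "length js = m - 1"
      "\<And>j. j \<in> set js \<Longrightarrow> x j \<noteq> 0" "A (l # js) \<noteq> 0"
    by (rule irreducible_tensorE[OF irr]) auto
  note a = nonneg_tensorD[OF A(1,2)]
  have "0 < Re (A (l # js)) * prod_list (map x js)"
  proof (intro mult_pos_pos prod_list_map_pos)
    show "0 < Re (A (l # js))" using a[OF l(2), of l] l(4) by (metis less_le of_real_0)
    show "0 < x j" if "j \<in> set js" for j using l(3)[OF that] x(1)[of j] by simp
  qed
  also have "\<dots> \<le> real_apply m A x l"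
    unfolding real_apply_def
    by (intro member_le_sum mult_nonneg_nonneg prod_list_map_nonneg x(1) finite_lists_length)
       (use l(2) a(2) in auto)
  also have "\<dots> = 0" using eig[of l] l(1) A(2) by (simp add: power_0_left)
  finally show False by simp
qed

section \<open>Existence and uniqueness of the Perron vector\<close>

lemma continuous_on_prod_list_map:
  fixes f :: "'n \<Rightarrow> 'a::topological_space \<Rightarrow> real"
  assumes "\<And>j. continuous_on S (f j)"
  shows "continuous_on S (\<lambda>x. prod_list (map (\<lambda>j. f j x) js))"
  by (induction js) (auto intro!: continuous_intros assms)

lemma compact_convex_probability_simplex:
  fixes S :: "(real ^ 'n::finite) set"
  defines "S \<equiv> {x. (\<forall>i. 0 \<le> x $ i) \<and> (\<Sum>i\<in>UNIV. x $ i) = 1}"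
  shows "compact S" "convex S" "S \<noteq> {}"
proof -
  have "closed S" unfolding S_def
    by (intro closed_Collect_conj closed_Collect_all closed_Collect_le closed_Collect_eq continuous_intros)
  moreover have "norm x \<le> 1" if "x \<in> S" for x
    using norm_le_l1_cart[of x] that by (simp add: S_def)
  ultimately show "compact S" by (auto simp: compact_eq_bounded_closed bounded_iff)
  show "convex S"
    by (auto simp: convex_def S_def sum.distrib simp flip: sum_distrib_left)
  have "(\<chi> i. 1 / real CARD('n)) \<in> S" by (simp add: S_def)
  then show "S \<noteq> {}" by blast
qed

text \<open>
  Brouwer's theorem is applied to the normalized entrywise \<open>(m - 1)\<close>-th root of
  \<open>vec_power x (m - 1) + A x\<close>; the first summand keeps the image away from \<open>0\<close>.
\<close>

lemma perron_vector_exists: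
  fixes A :: "'n::finite tensor"
  assumes A: "nonneg_tensor m A" "m \<ge> 2" and irr: "irreducible_tensor m A"
  obtains x :: "'n \<Rightarrow> real" and r where "\<And>i. 0 < x i" "0 \<le> r"
    "\<And>i. real_apply m A x i = r * x i ^ (m - 1)"
proof -
  define S :: "(real ^ 'n) set" where "S = {x. (\<forall>i. 0 \<le> x $ i) \<and> (\<Sum>i\<in>UNIV. x $ i) = 1}"
  define R :: "real ^ 'n \<Rightarrow> 'n \<Rightarrow> real"
    where "R x i = root (m - 1) ((x $ i) ^ (m - 1) + real_apply m A (($) x) i)" for x i
  define F :: "real ^ 'n \<Rightarrow> real ^ 'n" where "F x = (\<chi> i. R x i / (\<Sum>j\<in>UNIV. R x j))" for x
  have m: "m - 1 > 0" using A(2) by simp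
  have ap: "0 \<le> real_apply m A (($) x) i" if "x \<in> S" for x i
    using that by (intro real_apply_nonneg[OF A]) (auto simp: S_def)
  have R0: "0 \<le> R x i" if "x \<in> S" for x i
    using that ap[OF that] m by (auto simp: R_def S_def)
  have ex: "\<exists>i. 0 < x $ i" if "x \<in> S" for x :: "real ^ 'n"
  proof (rule ccontr)
    assume "\<not> ?thesis"
    then have "x $ i = 0" for i using that by (auto simp: S_def intro: antisym simp: not_less)
    then show False using that by (simp add: S_def)
  qed
  have pos: "0 < (\<Sum>j\<in>UNIV. R x j)" if "x \<in> S" for x
  proof -
    obtain i where "0 < x $ i" using ex[OF \<open>x \<in> S\<close>] by blast
    then have "0 < R x i"
      using ap[OF that, of i] m by (simp add: R_def add_pos_nonneg)
    then show ?thesis using R0[OF that] by (intro sum_pos2[of _ i]) auto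
  qed
  have contR: "continuous_on S (\<lambda>x. R x i)" for i
    unfolding R_def real_apply_def
    by (intro continuous_on_real_root continuous_intros continuous_on_prod_list_map)
  have contF: "continuous_on S F"
    unfolding F_def using contR pos by (intro continuous_intros) (auto simp: less_imp_neq[symmetric])
  have FS: "F \<in> S \<rightarrow> S"
  proof
    fix x assume x: "x \<in> S"
    show "F x \<in> S"
      using R0[OF x] pos[OF x] by (auto simp: S_def F_def sum_nonneg simp flip: sum_divide_distrib)
  qed
  obtain x where x: "x \<in> S" "F x = x"
    by (rule brouwer[OF compact_convex_probability_simplex[where 'n = 'n, folded S_def] contF FS])
  define s where "s = (\<Sum>j\<in>UNIV. R x j)"
  \<comment> \<open>The fixed point satisfies \<open>R x i = s * x $ i\<close>; after taking powers,
    the added summand \<open>(x $ i) ^ (m - 1)\<close> accounts for the 1 subtracted here.\<close>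
  define r where "r = s ^ (m - 1) - 1"
  have eig: "real_apply m A (($) x) i = r * (x $ i) ^ (m - 1)" for i
  proof -
    have "R x i = s * x $ i"
      using arg_cong[OF x(2), of "\<lambda>v. v $ i"] pos[OF x(1)] by (simp add: F_def s_def field_simps)
    moreover have "R x i ^ (m - 1) = (x $ i) ^ (m - 1) + real_apply m A (($) x) i"
      unfolding R_def using m ap[OF x(1), of i] x(1) by (intro real_root_pow_pos2) (auto simp: S_def)
    ultimately show ?thesis by (simp add: r_def algebra_simps power_mult_distrib)
  qed
  obtain i0 where i0: "0 < x $ i0" using ex[OF x(1)] by blast
  have "0 \<le> r * (x $ i0) ^ (m - 1)" using ap[OF x(1), of i0] eig by simp
  then have "0 \<le> r" using i0 by (simp add: zero_le_mult_iff) (metis not_less zero_less_power)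
  moreover have "0 < x $ i" for i
    using perron_vector_pos[OF A irr, of "($) x" r] eig i0 x(1) by (force simp: S_def)
  ultimately show thesis using that[of "($) x" r] eig by blast
qed

text \<open>Let \<open>t\<close> be least such that \<open>u\<close> lies below \<open>t\<close>
  times \<open>x\<close>. A coordinate of contact forces \<open>s = r\<close>. If contact were not
  everywhere, irreducibility would give a contact coordinate depending on non-contact ones only, and
  monotonicity would be strict there.\<close>

lemma perron_vector_unique:
  fixes A :: "'n::finite tensor"
  assumes A: "nonneg_tensor m A" "m \<ge> 2" and irr: "irreducible_tensor m A"
    and x: "\<And>i. 0 < x i" "\<And>i. real_apply m A x i = r * x i ^ (m - 1)"
    and u: "\<And>i. 0 \<le> u i" "\<exists>i. u i \<noteq> 0" "\<And>i. s * u i ^ (m - 1) \<le> real_apply m A u i"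
    and "r \<le> s"
  obtains t where "t > 0" "\<And>i. u i = t * x i" "s = r"
proof -
  define t where "t = Max (range (\<lambda>i. u i / x i))"
  have "t \<in> range (\<lambda>i. u i / x i)" unfolding t_def by (intro Max_in) auto
  then obtain i0 where i0: "t = u i0 / x i0" by blast
  have le: "u i \<le> t * x i" for i
  proof -
    have "u i / x i \<le> t" unfolding t_def by (intro Max_ge) auto
    then show ?thesis using x(1)[of i] by (simp add: field_simps)
  qed
  obtain i1 where "0 < u i1" using u(1,2) by (metis less_le)
  then have "t > 0" using le[of i1] x(1)[of i1] by (smt (verit) mult_nonpos_nonneg)
  have up: "real_apply m A u i \<le> r * (t * x i) ^ (m - 1)" for i
    using real_apply_mono[OF A, of u "\<lambda>i. t * x i" i] u(1) le by (simp add: real_apply_cmult x(2) power_mult_distrib ac_simps)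
  have "u i0 = t * x i0" using x(1)[of i0] by (simp add: i0)
  then have "s * (t * x i0) ^ (m - 1) \<le> r * (t * x i0) ^ (m - 1)"
    using up[of i0] u(3)[of i0] by simp
  moreover have "0 < (t * x i0) ^ (m - 1)" using \<open>t > 0\<close> x(1) by simp
  ultimately have sr: "s = r" using \<open>r \<le> s\<close> by (simp add: mult_le_cancel_right)
  have "{i. u i = t * x i} = UNIV"
  proof (rule ccontr)
    assume "{i. u i = t * x i} \<noteq> UNIV"
    moreover have "{i. u i = t * x i} \<noteq> {}" using \<open>u i0 = t * x i0\<close> by auto
    ultimately obtain i js where i: "u i = t * x i" "length js = m - 1"
        "\<And>j. j \<in> set js \<Longrightarrow> u j \<noteq> t * x j" "A (i # js) \<noteq> 0"
      by - (rule irreducible_tensorE[OF irr, of "{i. u i = t * x i}"], auto)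
    note a = nonneg_tensorD[OF A(1,2)]
    have "real_apply m A u i < real_apply m A (\<lambda>j. t * x j) i"
      unfolding real_apply_def
    proof (intro sum_strict_mono_ex1 ballI bexI)
      show "finite {js :: 'n list. length js = m - 1}" by (rule finite_lists_length)
      show "Re (A (i # js)) * prod_list (map u js) \<le> Re (A (i # js)) * prod_list (map (\<lambda>j. t * x j) js)"
        if "js \<in> {js. length js = m - 1}" for js
        using that a(2) u(1) le by (intro mult_left_mono prod_list_map_mono) auto
      show "js \<in> {js. length js = m - 1}" using i(2) by simp
      have "js \<noteq> []" using i(2) A(2) by auto
      then have "prod_list (map u js) < prod_list (map (\<lambda>j. t * x j) js)"
        using i(3) u(1) le by (intro prod_list_map_strict_mono) (auto simp: less_le)
      moreover have "0 < Re (A (i # js))" using a[OF i(2), of i] i(4) by (metis less_le of_real_0)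
      ultimately show "Re (A (i # js)) * prod_list (map u js) < Re (A (i # js)) * prod_list (map (\<lambda>j. t * x j) js)"
        by simp
    qed
    also have "\<dots> = s * u i ^ (m - 1)"
      by (simp add: real_apply_cmult x(2) power_mult_distrib i(1) sr)
    finally show False using u(3)[of i] by simp
  qed
  then show thesis using that \<open>t > 0\<close> sr by blast
qed

text \<open>Equality case of the triangle inequality: after rotating the sum onto the positive real
  axis, each real part is at most the modulus, and equality of the totals forces equality
  termwise.\<close>

lemma norm_sum_eq_imp_aligned:
  fixes c :: "'a \<Rightarrow> complex"
  assumes "finite S" "cmod (sum c S) = (\<Sum>j\<in>S. cmod (c j))" "j \<in> S"
  shows "c j = of_real (cmod (c j)) * sgn (sum c S)"
proof (cases "sum c S = 0")
  case True
  then show ?thesis using assms by (simp add: sum_nonneg_eq_0_iff)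
next
  case False
  define s where "s = sgn (sum c S)"
  have s: "cmod s = 1" using False by (simp add: s_def norm_sgn)
  then have ss: "s * cnj s = 1" by (simp add: complex_norm_square[symmetric])
  have "sum c S * cnj s = of_real (cmod (sum c S))"
    using ss by (simp add: s_def sgn_eq field_simps)
  then have "Re (\<Sum>j\<in>S. c j * cnj s) = (\<Sum>j\<in>S. cmod (c j))"
    using assms(2) by (simp flip: sum_distrib_right)
  then have "(\<Sum>j\<in>S. cmod (c j) - Re (c j * cnj s)) = 0"
    by (simp add: sum_subtractf Re_sum)
  moreover have le: "Re (c j * cnj s) \<le> cmod (c j)" for j
    using complex_Re_le_cmod[of "c j * cnj s"] s by (simp add: norm_mult)
  ultimately have "cmod (c j) = Re (c j * cnj s)"
    using assms(1,3) by (subst (asm) sum_nonneg_eq_0_iff) auto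
  then have "Re (c j * cnj s) = cmod (c j * cnj s)" using s by (simp add: norm_mult)
  \<comment> \<open>A number whose real part equals its modulus has imaginary part 0.\<close>
  then have "c j * cnj s = of_real (cmod (c j * cnj s))"
    using cmod_power2[of "c j * cnj s"] by (intro complex_eqI) (simp_all)
  then have "c j * cnj s * s = of_real (cmod (c j)) * s"
    using s by (simp add: norm_mult)
  moreover have "c j * cnj s * s = c j" using ss by (simp add: ac_simps)
  ultimately show ?thesis by (simp only: s_def)
qed

section \<open>The peripheral spectrum\<close>

text \<open>The second claim rewrites the upper bound as a sum of moduli, the form needed for the
  equality case.\<close>

lemma cmod_tensor_apply_le:
  assumes "nonneg_tensor m A" "m \<ge> 2"
  shows "cmod (tensor_apply m A y $ i) \<le> real_apply m A (\<lambda>j. cmod (y $ j)) i"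
    and "real_apply m A (\<lambda>j. cmod (y $ j)) i =
      (\<Sum>js | length js = m - 1. cmod (A (i # js) * prod_list (map (($) y) js)))"
proof -
  have norm_prod: "cmod (prod_list (map (($) y) js)) = prod_list (map (\<lambda>j. cmod (y $ j)) js)" for js
    by (induction js) (simp_all add: norm_mult)
  have "cmod (A (i # js)) = Re (A (i # js))" if "length js = m - 1" for js
    using nonneg_tensorD[OF assms that, of i] by (metis abs_of_nonneg norm_of_real)
  then show *: "real_apply m A (\<lambda>j. cmod (y $ j)) i =
      (\<Sum>js | length js = m - 1. cmod (A (i # js) * prod_list (map (($) y) js)))"
    unfolding real_apply_def by (intro sum.cong refl) (simp add: norm_mult norm_prod)
  show "cmod (tensor_apply m A y $ i) \<le> real_apply m A (\<lambda>j. cmod (y $ j)) i"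
    unfolding * tensor_apply_nth by (rule norm_sum)
qed

text \<open>All nonzero terms of row \<open>i\<close> acquire the same factor
  \<open>w * d i ^ (m - 1)\<close>.\<close>

lemma tensor_apply_phase:
  fixes A :: "'n::finite tensor" and x :: "'n \<Rightarrow> real"
  assumes A: "nonneg_tensor m A" "m \<ge> 2" and sym: "phase_symmetry m A w d"
  shows "tensor_apply m A (\<chi> i. d i * of_real (x i)) $ i = w * d i ^ (m - 1) * of_real (real_apply m A x i)"
proof -
  have prod: "prod_list (map (\<lambda>j. d j * of_real (x j)) js) = prod_list (map d js) * of_real (prod_list (map x js))" for js
    by (induction js) simp_all
  have "A (i # js) * prod_list (map (\<lambda>j. d j * of_real (x j)) js) =
      w * d i ^ (m - 1) * of_real (Re (A (i # js)) * prod_list (map x js))" if "length js = m - 1" for js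
  proof (cases "A (i # js) = 0")
    case False
    then have "prod_list (map d js) = w * d i ^ (m - 1)"
      using sym that by (simp add: phase_symmetry_def)
    then show ?thesis
      unfolding prod by (subst nonneg_tensorD(1)[OF A that]) simp
  qed simp
  moreover have "($) (\<chi> i. d i * complex_of_real (x i)) = (\<lambda>i. d i * of_real (x i))"
    by (simp add: fun_eq_iff)
  ultimately show ?thesis
    by (simp add: tensor_apply_nth real_apply_def sum_distrib_left)
qed

text \<open>Attaching the phases \<open>d\<close> to the Perron vector gives an eigenvector.\<close>

lemma phase_symmetry_eigenvalue:
  fixes A :: "'n::finite tensor"
  assumes A: "nonneg_tensor m A" "m \<ge> 2" and sym: "phase_symmetry m A w d"
    and x: "\<And>i. 0 < x i" "\<And>i. real_apply m A x i = r * x i ^ (m - 1)"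
  shows "w * of_real r \<in> tensor_eigenvalues m A"
proof -
  have d: "d i \<noteq> 0" for i
    using sym unfolding phase_symmetry_def by (metis norm_zero zero_neq_one)
  define y where "y = (\<chi> i. d i * complex_of_real (x i))"
  have "y $ i \<noteq> 0" for i
    using d x(1)[of i] by (simp add: y_def)
  then have "y \<noteq> 0" by auto
  moreover have "tensor_apply m A y = (w * of_real r) *s vec_power y (m - 1)"
    unfolding vec_eq_iff y_def
    by (simp only: tensor_apply_phase[OF A sym]) (simp add: x(2) vec_power_def power_mult_distrib)
  ultimately show ?thesis unfolding tensor_eigenvalues_def by blast
qed

text \<open>The assumption \<open>r \<le> cmod z\<close> serves two purposes: no eigenvalue has
  modulus above \<open>r\<close>, and each one of modulus \<open>r\<close> comes from a phase
  symmetry.\<close>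

lemma eigenvalue_phase_symmetry:
  fixes A :: "'n::finite tensor"
  assumes A: "nonneg_tensor m A" "m \<ge> 2" and irr: "irreducible_tensor m A"
    and x: "\<And>i. 0 < x i" "0 \<le> r" "\<And>i. real_apply m A x i = r * x i ^ (m - 1)"
    and z: "z \<in> tensor_eigenvalues m A" "r \<le> cmod z"
  shows "cmod z = r" and "r > 0 \<Longrightarrow> \<exists>d. phase_symmetry m A (z / of_real r) d"
proof -
  obtain y where y: "y \<noteq> 0" "tensor_apply m A y = z *s vec_power y (m - 1)"
    using z(1) unfolding tensor_eigenvalues_def by blast
  define u where "u = (\<lambda>i. cmod (y $ i))"
  have Ay: "tensor_apply m A y $ i = z * (y $ i) ^ (m - 1)" for i
    by (simp add: y(2) vec_power_def)
  have cAy: "cmod (tensor_apply m A y $ i) = cmod z * u i ^ (m - 1)" for i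
    by (simp add: Ay norm_mult norm_power u_def)
  have "\<exists>i. u i \<noteq> 0" using y(1) by (auto simp: u_def vec_eq_iff)
  moreover have "cmod z * u i ^ (m - 1) \<le> real_apply m A u i" for i
    using cmod_tensor_apply_le(1)[OF A, of y i] cAy[of i] unfolding u_def by simp
  moreover have "0 \<le> u i" for i by (simp add: u_def)
  ultimately obtain t where t: "t > 0" "\<And>i. u i = t * x i" "cmod z = r"
    using perron_vector_unique[OF A irr x(1,3), of u "cmod z"] z(2) by blast
  show "cmod z = r" by (rule t(3))
  assume "r > 0"
  define d where "d = (\<lambda>i. y $ i / of_real (u i))"
  have u: "u i > 0" for i using t x(1) by simp
  have yd: "y $ i = d i * of_real (u i)" for i
    using u[of i] by (simp add: d_def)
  have d: "cmod (d i) = 1" for i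
    using u[of i] by (simp add: d_def norm_divide) (simp add: u_def)
  have eq: "cmod (tensor_apply m A y $ i) = real_apply m A u i" for i
  proof -
    have "real_apply m A u i = real_apply m A (\<lambda>j. t * x j) i" using t(2) by presburger
    then show ?thesis
      by (simp add: cAy real_apply_cmult x(3) t(2,3) power_mult_distrib)
  qed
  have "prod_list (map d js) = z / of_real r * d i ^ (m - 1)"
    if js: "length js = m - 1" and nz: "A (i # js) \<noteq> 0" for i js
  proof -
    define c where "c = (\<lambda>js. A (i # js) * prod_list (map (($) y) js))"
    have "c js = of_real (cmod (c js)) * sgn (sum c {js. length js = m - 1})"
    proof (rule norm_sum_eq_imp_aligned)
      show "cmod (sum c {js. length js = m - 1}) = (\<Sum>js | length js = m - 1. cmod (c js))"
        using eq[of i] cmod_tensor_apply_le(2)[OF A, of y i] by (simp add: c_def u_def tensor_apply_nth)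
    qed (use js finite_lists_length in auto)
    also have "sum c {js. length js = m - 1} = z * (y $ i) ^ (m - 1)"
      using Ay[of i] by (simp add: c_def tensor_apply_nth)
    \<comment> \<open>Here \<open>cmod z = r\<close> and \<open>cmod (y $ i) = u i\<close>, so
      normalizing gives exactly the phases.\<close>
    also have "sgn (z * (y $ i) ^ (m - 1)) = z / of_real r * d i ^ (m - 1)"
      by (simp add: sgn_eq norm_mult norm_power t(3) d_def u_def power_divide)
    finally have c1: "c js = of_real (cmod (c js)) * (z / of_real r * d i ^ (m - 1))" .
    have "prod_list (map (($) y) js) = prod_list (map d js) * of_real (prod_list (map u js))"
      by (induction js) (simp_all add: yd)
    then have c2: "c js = A (i # js) * of_real (prod_list (map u js)) * prod_list (map d js)"
      by (simp add: c_def)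
    have "cmod (prod_list (map d js)) = 1"
      by (induction js) (simp_all add: norm_mult d)
    moreover have "0 < prod_list (map u js)" using u by (intro prod_list_map_pos)
    moreover have "complex_of_real (cmod (A (i # js))) = A (i # js)"
      using nonneg_tensorD[OF A js, of i] by (metis abs_of_nonneg norm_of_real)
    ultimately have "of_real (cmod (c js)) = A (i # js) * of_real (prod_list (map u js))"
      unfolding c2 by (simp add: norm_mult)
    then have "A (i # js) * of_real (prod_list (map u js)) * prod_list (map d js) =
        A (i # js) * of_real (prod_list (map u js)) * (z / of_real r * d i ^ (m - 1))"
      using c1 c2 by simp
    then show ?thesis
      using nz \<open>0 < prod_list (map u js)\<close> by (metis less_irrefl mult_cancel_left mult_eq_0_iff of_real_eq_0_iff)
  qed
  then have "phase_symmetry m A (z / of_real r) d"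
    unfolding phase_symmetry_def using d t(3) \<open>r > 0\<close> by (simp add: norm_divide)
  then show "\<exists>d. phase_symmetry m A (z / of_real r) d" by blast
qed

section \<open>Eigenvalues as roots, and the group of admissible rotations\<close>

text \<open>In row \<open>i\<close> of the unit tensor only the constant list of \<open>i\<close>
  contributes, so null vectors of the pencil are the eigenvectors for \<open>z\<close>.\<close>

lemma tensor_apply_pencil:
  fixes A :: "'n::finite tensor"
  shows "tensor_apply m (\<lambda>idx. z * unit_tensor idx - A idx) x = z *s vec_power x (m - 1) - tensor_apply m A x"
proof -
  have "(\<Sum>js | length js = m - 1. unit_tensor (i # js) * prod_list (map (($) x) js)) = x $ i ^ (m - 1)" for i
  proof -
    have "(\<Sum>js | length js = m - 1. unit_tensor (i # js) * prod_list (map (($) x) js)) =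
        (\<Sum>js\<in>{replicate (m - 1) i}. unit_tensor (i # js) * prod_list (map (($) x) js))"
    proof (rule sum.mono_neutral_right)
      have "js = replicate (m - 1) i" if "length js = m - 1" "set js \<subseteq> {i}" for js
        using that by (metis replicate_eqI singletonD subsetD)
      then show "\<forall>js\<in>{js. length js = m - 1} - {replicate (m - 1) i}. unit_tensor (i # js) * prod_list (map (($) x) js) = 0"
        by (auto simp: unit_tensor_Cons)
    qed (auto simp: finite_lists_length)
    then show ?thesis by (simp add: unit_tensor_Cons prod_list_replicate set_replicate_conv_if)
  qed
  then show ?thesis
    by (simp add: vec_eq_iff tensor_apply_nth vec_power_def left_diff_distrib sum_subtractf
        mult.assoc flip: sum_distrib_left)
qed

lemma poly_tensor_charpoly_eq_0_iff:
  assumes "is_hyperdeterminant m Det"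
  shows "poly (tensor_charpoly Det A) z = 0 \<longleftrightarrow> z \<in> tensor_eigenvalues m A"
  unfolding poly_tensor_charpoly mpoly_eval_eq_0_iff[OF assms] tensor_apply_pencil
    tensor_eigenvalues_def mem_Collect_eq right_minus_eq
  by metis

text \<open>Multiplication by \<open>w\<close> permutes \<open>W\<close>, so comparing the products
  of all elements gives \<open>w ^ card W = 1\<close>. There are only \<open>card W\<close> such
  roots of unity, hence equality.\<close>

lemma finite_group_eq_roots_unity:
  fixes W :: "complex set"
  assumes "finite W" "1 \<in> W" "0 \<notin> W" "\<And>v w. v \<in> W \<Longrightarrow> w \<in> W \<Longrightarrow> v * w \<in> W"
  shows "W = {z. z ^ card W = 1}"
proof (rule card_subset_eq)
  have card: "card W > 0" using assms(1,2) by (auto simp: card_gt_0_iff)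
  then show "finite {z::complex. z ^ card W = 1}" by (intro finite_roots_unity) simp
  show "card W = card {z::complex. z ^ card W = 1}" using card by (simp add: card_roots_unity_eq)
  have "w ^ card W = 1" if "w \<in> W" for w
  proof -
    have inj: "inj_on (\<lambda>v. w * v) W" using that assms(3) by (auto simp: inj_on_def)
    have "(\<lambda>v. w * v) ` W = W"
      using assms(4)[OF that] inj assms(1) by (intro endo_inj_surj) auto
    then have "(\<Prod>v\<in>W. v) = (\<Prod>v\<in>W. w * v)"
      using prod.reindex[OF inj, of "\<lambda>v. v"] by simp
    also have "\<dots> = w ^ card W * (\<Prod>v\<in>W. v)" by (simp add: prod.distrib)
    finally show ?thesis using assms(1,3) by auto
  qed
  then show "W \<subseteq> {z. z ^ card W = 1}" by blast
qed

text \<open>For positive \<open>r\<close> the eigenvalues of maximal modulus are \<open>r\<close>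
  times the admissible rotations, so the cyclic index is the order of that group, which contains
  every root of unity of this order.\<close>

lemma cyclic_index_phase_symmetry:
  fixes A :: "'n::finite tensor"
  assumes "m \<ge> 2" and det: "is_hyperdeterminant m Det"
    and A: "nonneg_tensor m A" and irr: "irreducible_tensor m A"
  obtains d where "tensor_charpoly Det A \<noteq> 0" "cyclic_index m A > 0"
    "phase_symmetry m A (cis (2 * pi / real (cyclic_index m A))) d"
proof -
  obtain x :: "'n \<Rightarrow> real" and r where x: "\<And>i. 0 < x i" "0 \<le> r" "\<And>i. real_apply m A x i = r * x i ^ (m - 1)"
    using perron_vector_exists[OF A \<open>m \<ge> 2\<close> irr] by blast
  note eig = eigenvalue_phase_symmetry[OF A \<open>m \<ge> 2\<close> irr x]
  let ?E = "tensor_eigenvalues m A" and ?S = "{z \<in> tensor_eigenvalues m A. cmod z = tensor_spectral_radius m A}"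
  have prod_list_1: "prod_list (map (\<lambda>_. 1) js) = (1::complex)" for js :: "'n list" by (induction js) simp_all
  then have one: "phase_symmetry m A 1 (\<lambda>_. 1)" by (simp add: phase_symmetry_def)
  \<comment> \<open>A single number that is not an eigenvalue makes the characteristic polynomial
    nonzero; the spectrum is then finite, so \<open>Max\<close> and \<open>card\<close> have their
    intended meaning.\<close>
  have "of_real (r + 1) \<notin> ?E" using eig(1)[of "of_real (r + 1)"] x(2) by auto
  then have nz: "tensor_charpoly Det A \<noteq> 0"
    using poly_tensor_charpoly_eq_0_iff[OF det, of A "of_real (r + 1)"] by auto
  then have fin: "finite ?E"
    using poly_roots_finite[of "tensor_charpoly Det A"] poly_tensor_charpoly_eq_0_iff[OF det, of A] by simp
  have rE: "of_real r \<in> ?E"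
    using phase_symmetry_eigenvalue[OF A \<open>m \<ge> 2\<close> one x(1,3)] by simp
  have rho: "tensor_spectral_radius m A = r"
    unfolding tensor_spectral_radius_def
  proof (rule Max_eqI)
    show "c \<le> r" if "c \<in> cmod ` ?E" for c
      using that eig(1) by (metis imageE linear)
    show "r \<in> cmod ` ?E" using rE x(2) by (intro image_eqI[of _ _ "of_real r"]) simp_all
  qed (use fin in simp)
  have pos: "cyclic_index m A > 0"
    unfolding cyclic_index_def using fin rE x(2) rho by (auto simp: card_gt_0_iff)
  define W where "W = {w. \<exists>d. phase_symmetry m A w d}"
  have "cis (2 * pi / real (cyclic_index m A)) \<in> W"
  proof (cases "r = 0")
    \<comment> \<open>Then 0 is the only eigenvalue of maximal modulus, so the cyclic index is 1 and
      the rotation is trivial.\<close>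
    case True
    then have "?S = {0}" using rE rho by auto
    then show ?thesis using one by (auto simp: cyclic_index_def W_def)
  next
    case False
    then have r: "r > 0" using x(2) by simp
    have W1: "cmod w = 1" if "w \<in> W" for w using that by (auto simp: W_def phase_symmetry_def)
    have S: "?S = (\<lambda>w. w * of_real r) ` W"
    proof (intro equalityI subsetI)
      fix z assume "z \<in> ?S"
      then have "z / of_real r \<in> W" using eig(2)[of z] r by (auto simp: W_def rho)
      then show "z \<in> (\<lambda>w. w * of_real r) ` W" using r by (intro image_eqI[of _ _ "z / of_real r"]) auto
    next
      fix z assume "z \<in> (\<lambda>w. w * of_real r) ` W"
      then obtain w where w: "w \<in> W" "z = w * of_real r" by blast
      then show "z \<in> ?S"
        using phase_symmetry_eigenvalue[OF A \<open>m \<ge> 2\<close> _ x(1,3)] W1[OF w(1)] r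
        by (auto simp: W_def rho norm_mult)
    qed
    have inj: "inj_on (\<lambda>w. w * of_real r :: complex) W" using r by (auto simp: inj_on_def)
    have card: "cyclic_index m A = card W"
      unfolding cyclic_index_def S using inj by (rule card_image)
    have "W = {z. z ^ card W = 1}"
    proof (rule finite_group_eq_roots_unity)
      have "finite ?S" using fin by simp
      then show "finite W" unfolding S using inj by (rule finite_imageD)
      show "v * w \<in> W" if "v \<in> W" "w \<in> W" for v w
        using that phase_symmetry_mult unfolding W_def by blast
      show "1 \<in> W" using one by (auto simp: W_def)
      show "0 \<notin> W" using W1[of 0] by auto
    qed
    moreover have "cis (2 * pi / real (card W)) ^ card W = 1"
      using pos card by (simp add: Complex.DeMoivre)
    ultimately show ?thesis using card by auto
  qed
  then show thesis using nz pos that unfolding W_def by blast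
qed

theorem theorem2p4:
  fixes A :: "'n::finite tensor" and Det :: "'n list mpoly" and m k :: nat
  assumes "m \<ge> 2"
    and "is_hyperdeterminant m Det"
    and "nonneg_tensor m A"
    and "irreducible_tensor m A"
    and "cyclic_index m A = k"
  shows "image_mset (\<lambda>z. cis (2 * pi / real k) * z) (tensor_spec Det A) = tensor_spec Det A \<and>
         (\<exists>(r::nat) (f::complex poly).
            tensor_charpoly Det A = monom 1 r * pcompose f (monom 1 k))"
proof -
  obtain d where nz: "tensor_charpoly Det A \<noteq> 0" and k: "k > 0"
      and sym: "phase_symmetry m A (cis (2 * pi / real k)) d"
    using cyclic_index_phase_symmetry[OF assms(1-4)] assms(5) by blast
  obtain c where "c \<noteq> 0"
      and rot: "pcompose (tensor_charpoly Det A) [:0, cis (2 * pi / real k):] = smult c (tensor_charpoly Det A)"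
    using tensor_charpoly_rotation[OF assms(1,2) sym] by blast
  then have "image_mset (\<lambda>z. cis (2 * pi / real k) * z) (tensor_spec Det A) = tensor_spec Det A"
    unfolding tensor_spec_def using nz by (intro proots_rotation_invariant) auto
  then show ?thesis using rotation_imp_pcompose_monom[OF nz k rot] by blast
qed

end
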